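(* Let $\mathcal D\subseteq\mathbb S^h\times\mathbb S^g$ be a free set that is closed with respect to restrictions to reducing subspaces and is $a^2$-convex, and let $r(a,x)$ be a symmetric noncommutative rational function with $\mathcal D$ contained in its domain. Then $r$ is $a^2$-convex on $\mathcal D$ if and only if $r$ is convex in $x$ on $\mathcal D$.
   Context: Let $h,g$ be positive integers. $\mathbb S_n^k$ is the set of $k$-tuples of $n\times n$ complex hermitian matrices. A subset $\mathcal D$ of $\mathbb S^h\times\mathbb S^g$ is a sequence $(\mathcal D_n)_n$ with $\mathcal D_n\subseteq\mathbb S^h_n\times\mathbb S^g_n$. It is free if closed under (componentwise) direct sums and simultaneous unitary conjugation. It is closed with respect to restrictions to reducing subspaces if whenever $(A,X)\in\mathcal D$ and $V$ is an isometry whose range reduces each $A_j$ and each $X_k$, then $V^*(A,X)V\in\mathcal D$ (where $V^*(A,X)V$ means conjugating every entry). It is $a^2$-convex if for each $(A,X)\in\mathcal D_n$ and isometry $V:\mathbb C^m\to\mathbb C^n$ such that $V^*A_j^2V=(V^*A_jV)^2$ for all $j$, one has $V^*(A,X)V\in\mathcal D$. A noncommutative rational function in freely noncommuting variables $a=(a_1,\dots,a_h)$, $x=(x_1,\dots,x_g)$ is given by a syntactically valid expression in $a,x,+,\cdot,(\,)^{-1}$ and complex scalars, evaluated on matrix tuples in the natural way; it is symmetric if $r(A,X)^*=r(A,X)$ for hermitian tuples in its domain. $r$ is $a^2$-convex on $\mathcal D$ if, whenever $(A,X)\in\mathcal D$ and $V:\mathbb C^m\to\mathbb C^n$ is an isometry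 with $V^*A_j^2V=(V^*A_jV)^2$ for all $j$ and $V^*(A,X)V\in\mathcal D$, we have $V^*r(A,X)V\succeq r(V^*(A,X)V)$. $r$ is convex in $x$ on $\mathcal D$ if $r(A,\frac{X+Y}2)\preceq\frac12(r(A,X)+r(A,Y))$ whenever $(A,X),(A,Y),(A,\frac{X+Y}2)\in\mathcal D$. *)

theory Defs
  imports
    "Jordan_Normal_Form.Schur_Decomposition"
    "Jordan_Normal_Form.Gauss_Jordan_Elimination"
begin

text \<open>The variables \<open>a\<close> and \<open>x\<close> are indexed by two finite (hence nonempty) types
  \<open>'h\<close> and \<open>'g\<close>, of cardinalities \<open>h\<close> and \<open>g\<close>. The matrix size is an explicit
  natural number, since it varies inside the statements.\<close>

type_synonym ('h, 'g) mat_tuple = "('h \<Rightarrow> complex mat) \<times> ('g \<Rightarrow> complex mat)"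

definition mat_tuples :: "nat \<Rightarrow> ('h, 'g) mat_tuple set" where
  "mat_tuples n =
    {(A, X). (\<forall>j. A j \<in> carrier_mat n n) \<and> (\<forall>k. X k \<in> carrier_mat n n)}"

definition herm_tuples :: "nat \<Rightarrow> ('h, 'g) mat_tuple set" where
  "herm_tuples n =
    {(A, X) \<in> mat_tuples n. (\<forall>j. mat_adjoint (A j) = A j) \<and> (\<forall>k. mat_adjoint (X k) = X k)}"

text \<open>Matrix sizes are positive: a graded set has an empty component at index \<open>0\<close>, and
  isometries are defined on \<open>\<complex>\<^sup>m\<close> with \<open>m > 0\<close>.\<close>

definition graded_subset :: "(nat \<Rightarrow> ('h, 'g) mat_tuple set) \<Rightarrow> bool" where
  "graded_subset D \<longleftrightarrow> D 0 = {} \<and> (\<forall>n. D n \<subseteq> herm_tuples n)"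

definition isometry_mat :: "nat \<Rightarrow> nat \<Rightarrow> complex mat \<Rightarrow> bool" where
  "isometry_mat n m V \<longleftrightarrow> 0 < m \<and> V \<in> carrier_mat n m \<and> mat_adjoint V * V = 1\<^sub>m m"

definition unitary_mat :: "nat \<Rightarrow> complex mat \<Rightarrow> bool" where
  "unitary_mat n U \<longleftrightarrow>
    U \<in> carrier_mat n n \<and> mat_adjoint U * U = 1\<^sub>m n \<and> U * mat_adjoint U = 1\<^sub>m n"

definition compress :: "complex mat \<Rightarrow> complex mat \<Rightarrow> complex mat" where
  "compress V M = mat_adjoint V * M * V"

definition compress_tuple :: "complex mat \<Rightarrow> ('h, 'g) mat_tuple \<Rightarrow> ('h, 'g) mat_tuple" where
  "compress_tuple V P = (\<lambda>j. compress V (fst P j), \<lambda>k. compress V (snd P k))"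

definition direct_sum :: "complex mat \<Rightarrow> complex mat \<Rightarrow> complex mat" where
  "direct_sum M N = diag_block_mat [M, N]"

definition direct_sum_tuple ::
  "('h, 'g) mat_tuple \<Rightarrow> ('h, 'g) mat_tuple \<Rightarrow> ('h, 'g) mat_tuple" where
  "direct_sum_tuple P Q =
    (\<lambda>j. direct_sum (fst P j) (fst Q j), \<lambda>k. direct_sum (snd P k) (snd Q k))"

definition free_set :: "(nat \<Rightarrow> ('h, 'g) mat_tuple set) \<Rightarrow> bool" where
  "free_set D \<longleftrightarrow>
    (\<forall>m n. \<forall>P \<in> D m. \<forall>Q \<in> D n. direct_sum_tuple P Q \<in> D (m + n)) \<and>
    (\<forall>n U. \<forall>P \<in> D n. unitary_mat n U \<longrightarrow> compress_tuple U P \<in> D n)"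

definition range_mat :: "complex mat \<Rightarrow> complex vec set" where
  "range_mat V = {V *\<^sub>v u | u. u \<in> carrier_vec (dim_col V)}"

definition orth_compl :: "nat \<Rightarrow> complex vec set \<Rightarrow> complex vec set" where
  "orth_compl n W = {v \<in> carrier_vec n. \<forall>w \<in> W. v \<bullet>c w = 0}"

definition reduces :: "nat \<Rightarrow> complex vec set \<Rightarrow> complex mat \<Rightarrow> bool" where
  "reduces n W T \<longleftrightarrow>
    (\<forall>w \<in> W. T *\<^sub>v w \<in> W) \<and> (\<forall>w \<in> orth_compl n W. T *\<^sub>v w \<in> orth_compl n W)"

definition closed_under_reducing :: "(nat \<Rightarrow> ('h, 'g) mat_tuple set) \<Rightarrow> bool" where
  "closed_under_reducing D \<longleftrightarrow>
    (\<forall>n m V A X. (A, X) \<in> D n \<and> isometry_mat n m V \<and>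
       (\<forall>j. reduces n (range_mat V) (A j)) \<and> (\<forall>k. reduces n (range_mat V) (X k))
       \<longrightarrow> compress_tuple V (A, X) \<in> D m)"

definition a2_isometry :: "nat \<Rightarrow> nat \<Rightarrow> complex mat \<Rightarrow> ('h \<Rightarrow> complex mat) \<Rightarrow> bool" where
  "a2_isometry n m V A \<longleftrightarrow> isometry_mat n m V \<and>
    (\<forall>j. compress V (A j * A j) = compress V (A j) * compress V (A j))"

definition a2_convex_set :: "(nat \<Rightarrow> ('h, 'g) mat_tuple set) \<Rightarrow> bool" where
  "a2_convex_set D \<longleftrightarrow>
    (\<forall>n m V A X. (A, X) \<in> D n \<and> a2_isometry n m V A \<longrightarrow> compress_tuple V (A, X) \<in> D m)"

datatype ('h, 'g) nc_expr =
    Scalar complex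
  | VarA 'h
  | VarX 'g
  | Add "('h, 'g) nc_expr" "('h, 'g) nc_expr"
  | Mult "('h, 'g) nc_expr" "('h, 'g) nc_expr"
  | Inverse "('h, 'g) nc_expr"

text \<open>Evaluation on \<open>n \<times> n\<close> tuples; \<open>None\<close> means that some inverse does not exist.\<close>

fun nc_eval :: "nat \<Rightarrow> ('h, 'g) nc_expr \<Rightarrow> ('h, 'g) mat_tuple \<Rightarrow> complex mat option" where
  "nc_eval n (Scalar c) P = Some (c \<cdot>\<^sub>m 1\<^sub>m n)"
| "nc_eval n (VarA j) P = Some (fst P j)"
| "nc_eval n (VarX k) P = Some (snd P k)"
| "nc_eval n (Add e f) P =
    Option.bind (nc_eval n e P) (\<lambda>M. Option.bind (nc_eval n f P) (\<lambda>N. Some (M + N)))"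
| "nc_eval n (Mult e f) P =
    Option.bind (nc_eval n e P) (\<lambda>M. Option.bind (nc_eval n f P) (\<lambda>N. Some (M * N)))"
| "nc_eval n (Inverse e) P = Option.bind (nc_eval n e P) mat_inverse"

text \<open>Expressions that agree wherever both are defined represent the same noncommutative
  rational function, whose domain is the union of their domains. A function is therefore given
  by a nonempty set of pairwise agreeing expressions. A singleton is the function given by one
  expression, on the domain of that expression; a full equivalence class of expressions has the
  largest domain.\<close>

definition nc_rational :: "('h, 'g) nc_expr set \<Rightarrow> bool" where
  "nc_rational r \<longleftrightarrow> r \<noteq> {} \<and>
    (\<forall>e \<in> r. \<forall>f \<in> r. \<forall>n. \<forall>P \<in> mat_tuples n. \<forall>M N.
       nc_eval n e P = Some M \<and> nc_eval n f P = Some N \<longrightarrow> M = N)"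

definition rat_dom :: "('h, 'g) nc_expr set \<Rightarrow> nat \<Rightarrow> ('h, 'g) mat_tuple set" where
  "rat_dom r n = {P \<in> mat_tuples n. \<exists>e \<in> r. nc_eval n e P \<noteq> None}"

definition rat_val :: "('h, 'g) nc_expr set \<Rightarrow> nat \<Rightarrow> ('h, 'g) mat_tuple \<Rightarrow> complex mat" where
  "rat_val r n P = (THE M. \<exists>e \<in> r. nc_eval n e P = Some M)"

lemma nc_rational_singleton: "nc_rational {e}"
  by (auto simp: nc_rational_def)

lemma rat_val_eq:
  assumes "nc_rational r" "e \<in> r" "P \<in> mat_tuples n" "nc_eval n e P = Some M"
  shows "rat_val r n P = M"
  unfolding rat_val_def using assms by (intro the_equality) (auto simp: nc_rational_def)

definition symmetric_rat :: "('h, 'g) nc_expr set \<Rightarrow> bool" where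
  "symmetric_rat r \<longleftrightarrow>
    (\<forall>n. \<forall>P \<in> rat_dom r n \<inter> herm_tuples n. mat_adjoint (rat_val r n P) = rat_val r n P)"

text \<open>In the order of \<open>complex\<close>, \<open>0 \<le> z\<close> means that \<open>z\<close> is real and nonnegative, so the
  quadratic form condition below also says that \<open>N - M\<close> is hermitian.\<close>

definition loewner_le :: "nat \<Rightarrow> complex mat \<Rightarrow> complex mat \<Rightarrow> bool" where
  "loewner_le n M N \<longleftrightarrow> M \<in> carrier_mat n n \<and> N \<in> carrier_mat n n \<and>
    (\<forall>v \<in> carrier_vec n. 0 \<le> ((N - M) *\<^sub>v v) \<bullet>c v)"

definition a2_convex_on ::
  "(nat \<Rightarrow> ('h, 'g) mat_tuple set) \<Rightarrow> ('h, 'g) nc_expr set \<Rightarrow> bool" where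
  "a2_convex_on D r \<longleftrightarrow>
    (\<forall>n m V A X. (A, X) \<in> D n \<and> a2_isometry n m V A \<and> compress_tuple V (A, X) \<in> D m
       \<longrightarrow> loewner_le m (rat_val r m (compress_tuple V (A, X)))
                         (compress V (rat_val r n (A, X))))"

definition midpoint_tuple ::
  "('g \<Rightarrow> complex mat) \<Rightarrow> ('g \<Rightarrow> complex mat) \<Rightarrow> 'g \<Rightarrow> complex mat" where
  "midpoint_tuple X Y = (\<lambda>k. (1 / 2) \<cdot>\<^sub>m (X k + Y k))"

definition convex_in_x_on ::
  "(nat \<Rightarrow> ('h, 'g) mat_tuple set) \<Rightarrow> ('h, 'g) nc_expr set \<Rightarrow> bool" where
  "convex_in_x_on D r \<longleftrightarrow>
    (\<forall>n A X Y. (A, X) \<in> D n \<and> (A, Y) \<in> D n \<and> (A, midpoint_tuple X Y) \<in> D n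
       \<longrightarrow> loewner_le n (rat_val r n (A, midpoint_tuple X Y))
                         ((1 / 2) \<cdot>\<^sub>m (rat_val r n (A, X) + rat_val r n (A, Y))))"

end

theory Submission
  imports Defs
begin

text \<open>Both properties are tested on isometries that intertwine the \<open>a\<close>-variables, and a rational
  function respects intertwiners. Compressing \<open>(A \<oplus> A, X \<oplus> Y)\<close> by
  \<open>(1/\<surd>2)[1; 1]\<close> gives \<open>(A, (X + Y)/2)\<close>, so \<open>a\<^sup>2\<close>-convexity implies convexity in \<open>x\<close>, and
  the set contains its midpoints. Conversely, the range of an admissible isometry \<open>V\<close>
  reduces \<open>A\<close>, so the reflection \<open>S = 2 V V\<^sup>* - 1\<close> is a unitary commuting with \<open>A\<close>.
  The midpoint of \<open>X\<close> and \<open>S X S\<close> is the block diagonal part of \<open>X\<close>, which the range of \<open>V\<close>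
  reduces and which has the same compression to it; convexity at this midpoint, compressed
  by \<open>V\<close>, is the \<open>a\<^sup>2\<close>-convexity inequality.\<close>

section \<open>Matrices\<close>

text \<open>Versions of the library laws whose side conditions the simplifier can discharge.\<close>

lemma mult_mat_assoc:
  fixes A B C :: "'a::semiring_0 mat"
  assumes "dim_col A = dim_row B" "dim_col B = dim_row C"
  shows "A * B * C = A * (B * C)"
  using assms by (intro assoc_mult_mat) auto

lemma mult_mat_vec_assoc:
  fixes A B :: "'a::semiring_0 mat"
  assumes "dim_col A = dim_row B" "dim_col B = dim_vec v"
  shows "A * B *\<^sub>v v = A *\<^sub>v (B *\<^sub>v v)"
  using assms by (intro assoc_mult_mat_vec carrier_matI carrier_vecI) auto

lemma smult_smult_mat: "a \<cdot>\<^sub>m (b \<cdot>\<^sub>m A) = (a * b :: 'a::semigroup_mult) \<cdot>\<^sub>m A"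
  by (intro eq_matI) (auto simp: mult.assoc)

lemma mult_mat_add:
  fixes A B C :: "'a::semiring_0 mat"
  assumes "dim_col A = dim_row B" "dim_row B = dim_row C" "dim_col B = dim_col C"
  shows "A * (B + C) = A * B + A * C"
  using assms by (intro mult_add_distrib_mat) auto

lemma add_mat_mult:
  fixes A B C :: "'a::semiring_0 mat"
  assumes "dim_col A = dim_row C" "dim_row A = dim_row B" "dim_col A = dim_col B"
  shows "(A + B) * C = A * C + B * C"
  using assms by (intro add_mult_distrib_mat) auto

lemma mult_mat_minus:
  fixes A B C :: "'a::ring mat"
  assumes "dim_col A = dim_row B" "dim_row B = dim_row C" "dim_col B = dim_col C"
  shows "A * (B - C) = A * B - A * C"
  using assms by (intro mult_minus_distrib_mat) auto

lemma minus_mat_mult: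
  fixes A B C :: "'a::ring mat"
  assumes "dim_col A = dim_row C" "dim_row A = dim_row B" "dim_col A = dim_col B"
  shows "(A - B) * C = A * C - B * C"
  using assms by (intro minus_mult_distrib_mat) auto

lemma mult_mat_smult:
  fixes A B :: "'a::comm_semiring_0 mat"
  assumes "dim_col A = dim_row B"
  shows "A * (c \<cdot>\<^sub>m B) = c \<cdot>\<^sub>m (A * B)"
  using assms by (intro mult_smult_distrib) auto

lemma smult_mat_mult:
  fixes A B :: "'a::comm_semiring_0 mat"
  assumes "dim_col A = dim_row B"
  shows "(c \<cdot>\<^sub>m A) * B = c \<cdot>\<^sub>m (A * B)"
  using assms by (intro mult_smult_assoc_mat) auto

lemmas mat_ring_simps =
  mult_mat_assoc mult_mat_add add_mat_mult mult_mat_minus minus_mat_mult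
  mult_mat_smult smult_mat_mult

lemma mat_add_diff_cancel:
  fixes M K :: "complex mat"
  assumes "dim_row M = dim_row K" "dim_col M = dim_col K"
  shows "M + (K - M) = K"
  using assms by (intro eq_matI) auto

lemma index_mult_mat_sum:
  fixes A B :: "'a::semiring_0 mat"
  assumes "i < dim_row A" "j < dim_col B" "dim_col A = dim_row B"
  shows "(A * B) $$ (i, j) = (\<Sum>k<dim_row B. A $$ (i, k) * B $$ (k, j))"
  using assms by (simp add: scalar_prod_def lessThan_atLeast0)

text \<open>\<open>V\<close> is moved past one factor at a time. This serves products in rational
  expressions and squares of the \<open>a\<close>-variables alike.\<close>

lemma mult_intertwined:
  fixes M1 M2 :: "'a::semiring_0 mat"
  assumes "M1 \<in> carrier_mat n n" "M2 \<in> carrier_mat n n"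
    and "N1 \<in> carrier_mat m m" "N2 \<in> carrier_mat m m" and "V \<in> carrier_mat n m"
    and "M1 * V = V * N1" "M2 * V = V * N2"
  shows "M1 * M2 * V = V * (N1 * N2)"
proof -
  have "M1 * M2 * V = M1 * (M2 * V)" using assms(1,2,5) by (simp add: mult_mat_assoc)
  also have "\<dots> = M1 * V * N2"
    unfolding assms(7) using assms(1,4,5) by (simp add: mult_mat_assoc)
  also have "\<dots> = V * (N1 * N2)"
    unfolding assms(6) using assms(3-5) by (simp add: mult_mat_assoc)
  finally show ?thesis .
qed

section \<open>Adjoints and Gram matrices\<close>

lemma dim_mat_adjoint [simp]:
  "dim_row (mat_adjoint A) = dim_col A" "dim_col (mat_adjoint A) = dim_row A"
  by (simp_all add: mat_adjoint_def)

lemma mat_adjoint_carrier [simp, intro]: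
  "A \<in> carrier_mat n m \<Longrightarrow> mat_adjoint A \<in> carrier_mat m n"
  by (intro carrier_matI) auto

lemma index_mat_adjoint [simp]:
  "i < dim_col A \<Longrightarrow> j < dim_row A \<Longrightarrow> mat_adjoint A $$ (i, j) = conjugate (A $$ (j, i))"
  by (simp add: mat_adjoint_def mat_of_rows_def)

lemma mat_adjoint_adjoint [simp]: "mat_adjoint (mat_adjoint A) = A"
  by (intro eq_matI) auto

lemma mat_adjoint_one [simp]: "mat_adjoint (1\<^sub>m n :: complex mat) = 1\<^sub>m n"
  by (intro eq_matI) auto

lemma mat_adjoint_add:
  fixes A B :: "complex mat"
  assumes "dim_row A = dim_row B" "dim_col A = dim_col B"
  shows "mat_adjoint (A + B) = mat_adjoint A + mat_adjoint B"
  using assms by (intro eq_matI) auto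

lemma mat_adjoint_minus:
  fixes A B :: "complex mat"
  assumes "dim_row A = dim_row B" "dim_col A = dim_col B"
  shows "mat_adjoint (A - B) = mat_adjoint A - mat_adjoint B"
  using assms by (intro eq_matI) auto

lemma mat_adjoint_smult:
  "mat_adjoint (c \<cdot>\<^sub>m A :: complex mat) = cnj c \<cdot>\<^sub>m mat_adjoint A"
  by (intro eq_matI) auto

lemma mat_adjoint_mult:
  fixes A B :: "complex mat"
  assumes "dim_col A = dim_row B"
  shows "mat_adjoint (A * B) = mat_adjoint B * mat_adjoint A"
  using assms
  by (intro eq_matI) (auto simp: scalar_prod_def mult.commute intro!: sum.cong)

lemma mat_adjoint_cscalar_prod:
  fixes V :: "complex mat"
  assumes "V \<in> carrier_mat n m" "u \<in> carrier_vec n" "v \<in> carrier_vec m"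
  shows "(mat_adjoint V *\<^sub>v u) \<bullet>c v = u \<bullet>c (V *\<^sub>v v)"
proof -
  have "(mat_adjoint V *\<^sub>v u) \<bullet>c v = (\<Sum>i<m. \<Sum>j<n. cnj (V $$ (j, i)) * u $ j * cnj (v $ i))"
    using assms by (auto simp: scalar_prod_def sum_distrib_right lessThan_atLeast0 intro!: sum.cong)
  also have "\<dots> = (\<Sum>j<n. \<Sum>i<m. cnj (V $$ (j, i)) * u $ j * cnj (v $ i))"
    by (rule sum.swap)
  also have "\<dots> = u \<bullet>c (V *\<^sub>v v)"
    using assms
    by (auto simp: scalar_prod_def sum_distrib_left lessThan_atLeast0 mult_ac intro!: sum.cong)
  finally show ?thesis .
qed

text \<open>The diagonal entries of the Gram matrix are the squared norms of the columns of
  \<open>Z\<close>.\<close>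

lemma adjoint_mult_self_eq_0:
  fixes Z :: "complex mat"
  assumes Z: "Z \<in> carrier_mat n m" and 0: "mat_adjoint Z * Z = 0\<^sub>m m m"
  shows "Z = 0\<^sub>m n m"
proof (intro eq_matI)
  fix i j assume "i < dim_row (0\<^sub>m n m :: complex mat)" "j < dim_col (0\<^sub>m n m :: complex mat)"
  then have ij: "i < n" "j < m" by auto
  have "(\<Sum>k<n. cnj (Z $$ (k, j)) * Z $$ (k, j)) = (mat_adjoint Z * Z) $$ (j, j)"
    using ij Z by (auto simp: scalar_prod_def lessThan_atLeast0 intro!: sum.cong)
  then have "(\<Sum>k<n. complex_of_real ((cmod (Z $$ (k, j)))\<^sup>2)) = 0"
    using 0 ij by (simp add: complex_norm_square mult.commute del: of_real_power)
  then have "(\<Sum>k<n. (cmod (Z $$ (k, j)))\<^sup>2) = 0"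
    by (metis of_real_eq_0_iff of_real_sum)
  then have "Z $$ (i, j) = 0"
    using ij by (subst (asm) sum_nonneg_eq_0_iff) auto
  then show "Z $$ (i, j) = 0\<^sub>m n m $$ (i, j)" using ij by simp
qed (use Z in auto)

section \<open>Compressions and the order\<close>

lemma compress_carrier [simp, intro]:
  "V \<in> carrier_mat n m \<Longrightarrow> compress V M \<in> carrier_mat m m"
  by (auto simp: compress_def intro!: carrier_matI)

lemma dim_compress [simp]: "dim_row (compress V M) = dim_col V" "dim_col (compress V M) = dim_col V"
  by (simp_all add: compress_def)

text \<open>Multiplying the intertwining relation by \<open>V\<^sup>*\<close> from the left cancels
  \<open>V\<close>. In this way the value of a rational function at a compressed tuple is read off
  as a compression.\<close>

lemma compress_intertwined:
  assumes "V \<in> carrier_mat n m" "mat_adjoint V * V = 1\<^sub>m m" "N \<in> carrier_mat m m"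
    "M \<in> carrier_mat n n" "M * V = V * N"
  shows "compress V M = N"
proof -
  have "compress V M = mat_adjoint V * (M * V)"
    using assms by (simp add: compress_def mult_mat_assoc)
  also have "\<dots> = (mat_adjoint V * V) * N"
    using assms(1,3,4) unfolding assms(5) by (simp add: mult_mat_assoc)
  finally show ?thesis using assms by simp
qed

text \<open>The quadratic form of a compression at \<open>v\<close> is the original form at
  \<open>V v\<close>.\<close>

lemma compress_loewner_le:
  assumes "loewner_le n M N" and V: "V \<in> carrier_mat n m"
  shows "loewner_le m (compress V M) (compress V N)"
  unfolding loewner_le_def
proof (intro conjI ballI)
  have M: "M \<in> carrier_mat n n" and N: "N \<in> carrier_mat n n"
    using assms by (auto simp: loewner_le_def)
  fix v :: "complex vec" assume v: "v \<in> carrier_vec m"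
  have "compress V N - compress V M = mat_adjoint V * ((N - M) * V)"
    using M N V by (simp add: compress_def mat_ring_simps)
  then have "(compress V N - compress V M) *\<^sub>v v = mat_adjoint V *\<^sub>v ((N - M) *\<^sub>v (V *\<^sub>v v))"
    using M N V v by (simp add: mult_mat_vec_assoc)
  moreover have "(N - M) *\<^sub>v (V *\<^sub>v v) \<in> carrier_vec n"
    using M by (intro carrier_vecI) simp
  ultimately have "((compress V N - compress V M) *\<^sub>v v) \<bullet>c v = ((N - M) *\<^sub>v (V *\<^sub>v v)) \<bullet>c (V *\<^sub>v v)"
    using mat_adjoint_cscalar_prod[OF V _ v] by simp
  moreover have "V *\<^sub>v v \<in> carrier_vec n"
    using V by (intro carrier_vecI) simp
  ultimately show "0 \<le> ((compress V N - compress V M) *\<^sub>v v) \<bullet>c v"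
    using assms(1) by (simp add: loewner_le_def)
qed (simp_all add: compress_carrier[OF V])

text \<open>The hypothesis says that \<open>A V - V V\<^sup>* A V\<close> has vanishing Gram matrix, so the range of
  \<open>V\<close> reduces \<open>A\<close>.\<close>

lemma compress_square_imp_intertwined:
  assumes V: "V \<in> carrier_mat n m" and iso: "mat_adjoint V * V = 1\<^sub>m m"
    and A: "A \<in> carrier_mat n n" and herm: "mat_adjoint A = A"
    and sq: "compress V (A * A) = compress V A * compress V A"
  shows "A * V = V * compress V A"
proof -
  define B where "B = compress V A"
  have B: "B \<in> carrier_mat m m" using V by (simp add: B_def)
  have B': "mat_adjoint V * (A * V) = B"
    using V A by (simp add: B_def compress_def mult_mat_assoc)
  have Bh: "mat_adjoint B = B"
    using V A herm by (simp add: B_def compress_def mat_adjoint_mult mult_mat_assoc)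
  define Z where "Z = A * V - V * B"
  have Z: "Z \<in> carrier_mat n m" using A V B by (auto simp: Z_def)
  have Zh: "mat_adjoint Z = mat_adjoint V * A - B * mat_adjoint V"
    using A V B by (simp add: Z_def mat_adjoint_minus mat_adjoint_mult Bh herm)
  \<comment> \<open>This is \<open>V\<^sup>* A V - B V\<^sup>* V\<close>, and both terms equal
    \<open>B\<close>.\<close>
  have ZV: "mat_adjoint Z * V = 0\<^sub>m m m"
    using A V B by (simp add: Zh mat_ring_simps iso B')
  \<comment> \<open>Here the hypothesis on squares enters: it makes \<open>Z\<close> orthogonal to
    \<open>A V\<close> as well, hence to itself.\<close>
  have "mat_adjoint V * (A * (A * V)) = B * B"
    using sq V A by (simp add: B_def compress_def mult_mat_assoc)
  then have ZAV: "mat_adjoint Z * (A * V) = 0\<^sub>m m m"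
    using A V B by (simp add: Zh mat_ring_simps B')
  have "mat_adjoint Z * Z = mat_adjoint Z * (A * V) - mat_adjoint Z * V * B"
    using A V B Z by (subst Z_def) (simp add: mat_ring_simps)
  then have "mat_adjoint Z * Z = 0\<^sub>m m m"
    using ZV ZAV B by simp
  from adjoint_mult_self_eq_0[OF Z this] have "Z = 0\<^sub>m n m" .
  then have "A * V = V * B"
    using mat_add_diff_cancel[of "V * B" "A * V"] A V B by (simp add: Z_def)
  then show ?thesis by (simp add: B_def)
qed

section \<open>Intertwiners and rational functions\<close>

text \<open>A left inverse of a square matrix is two-sided, so \<open>mat_inverse\<close> cannot
  fail, and by uniqueness of inverses it returns \<open>B\<close>.\<close>

lemma mat_inverse_eq_Some:
  fixes A :: "'a::field mat"
  assumes A: "A \<in> carrier_mat n n" and B: "B \<in> carrier_mat n n" and BA: "B * A = 1\<^sub>m n"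
  shows "mat_inverse A = Some B"
proof (cases "mat_inverse A")
  case None
  have "A * B = 1\<^sub>m n" using mat_mult_left_right_inverse[OF B A BA] .
  then have "A \<in> Units (ring_mat TYPE('a) n ())"
    using A B BA by (auto simp: Units_def ring_mat_def)
  then show ?thesis using mat_inverse(1)[OF A None, of "()"] by blast
next
  case (Some C)
  then have C: "A * C = 1\<^sub>m n" "C \<in> carrier_mat n n" using mat_inverse(2)[OF A] by auto
  have "B = B * (A * C)" using B C by simp
  also have "\<dots> = (B * A) * C" using A B C(2) by (simp add: mult_mat_assoc)
  finally show ?thesis using BA C(2) Some by simp
qed

lemma nc_eval_carrier:
  assumes "P \<in> mat_tuples n" "nc_eval n e P = Some M"
  shows "M \<in> carrier_mat n n"
  using assms
proof (induction e arbitrary: M)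
  case (Inverse e)
  then obtain N where "N \<in> carrier_mat n n" "mat_inverse N = Some M"
    by (auto split: bind_splits)
  then show ?case by (simp add: mat_inverse(2))
next
  case (Add e f)
  then show ?case by (auto split: bind_splits)
next
  case (Mult e f)
  then obtain M1 M2 where "M1 \<in> carrier_mat n n" "M2 \<in> carrier_mat n n" "M = M1 * M2"
    by (auto split: bind_splits)
  then show ?case by simp
qed (auto simp: mat_tuples_def)

text \<open>Induction on the expression. That \<open>e\<close> is defined at \<open>Q\<close> is
  part of the conclusion: the left inverse \<open>L\<close> makes \<open>V\<close> injective, so a
  matrix intertwined with an invertible one is injective, hence invertible.\<close>

lemma nc_eval_intertwined:
  assumes P: "P \<in> mat_tuples n" and Q: "Q \<in> mat_tuples m"
    and V: "V \<in> carrier_mat n m" and L: "L \<in> carrier_mat m n" and LV: "L * V = 1\<^sub>m m"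
    and "\<And>j. fst P j * V = V * fst Q j" and "\<And>k. snd P k * V = V * snd Q k"
    and "nc_eval n e P = Some M"
  shows "\<exists>N. nc_eval m e Q = Some N \<and> M * V = V * N"
  using assms(8)
proof (induction e arbitrary: M)
  case (Scalar c)
  then show ?case using V by (auto simp: mult_mat_smult smult_mat_mult)
next
  case (Add e f)
  then obtain M1 M2 N1 N2 where
    ev: "nc_eval n e P = Some M1" "nc_eval n f P = Some M2" "M = M1 + M2"
      "nc_eval m e Q = Some N1" "nc_eval m f Q = Some N2" "M1 * V = V * N1" "M2 * V = V * N2"
    by (auto split: bind_splits)
  have "M1 \<in> carrier_mat n n" "M2 \<in> carrier_mat n n" "N1 \<in> carrier_mat m m" "N2 \<in> carrier_mat m m"
    using ev nc_eval_carrier P Q by blast+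
  then show ?case using ev V by (simp add: mat_ring_simps)
next
  case (Mult e f)
  then obtain M1 M2 N1 N2 where
    ev: "nc_eval n e P = Some M1" "nc_eval n f P = Some M2" "M = M1 * M2"
      "nc_eval m e Q = Some N1" "nc_eval m f Q = Some N2" "M1 * V = V * N1" "M2 * V = V * N2"
    by (auto split: bind_splits)
  have c: "M1 \<in> carrier_mat n n" "M2 \<in> carrier_mat n n" "N1 \<in> carrier_mat m m" "N2 \<in> carrier_mat m m"
    using ev nc_eval_carrier P Q by blast+
  show ?case using ev(3-5) mult_intertwined[OF c V ev(6,7)] by simp
next
  case (Inverse e)
  then obtain M1 N1 where
    ev: "nc_eval n e P = Some M1" "mat_inverse M1 = Some M"
      "nc_eval m e Q = Some N1" "M1 * V = V * N1"
    by (auto split: bind_splits)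
  have c: "M1 \<in> carrier_mat n n" "N1 \<in> carrier_mat m m"
    using ev nc_eval_carrier P Q by blast+
  have M: "M1 * M = 1\<^sub>m n" "M * M1 = 1\<^sub>m n" "M \<in> carrier_mat n n"
    using mat_inverse(2)[OF c(1) ev(2)] by auto
  \<comment> \<open>The desired relation \<open>M V = V N\<close> forces this choice after
    multiplication by \<open>L\<close>.\<close>
  define N where "N = L * (M * V)"
  have N: "N \<in> carrier_mat m m" using L M(3) V by (auto simp: N_def)
  have MVN: "M * V * N1 = V"
  proof -
    have "M * V * N1 = M * (M1 * V)"
      unfolding ev(4) using M(3) V c by (simp add: mult_mat_assoc)
    also have "\<dots> = (M * M1) * V" using M(3) V c by (simp add: mult_mat_assoc)
    finally show ?thesis using M V by simp
  qed
  have NN1: "N * N1 = 1\<^sub>m m"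
    using L M(3) V c MVN LV by (simp add: N_def mult_mat_assoc)
  have "mat_inverse N1 = Some N" by (rule mat_inverse_eq_Some[OF c(2) N NN1])
  \<comment> \<open>Since \<open>N\<close> is also a right inverse of \<open>N1\<close>, the
    identity \<open>M V N1 = V\<close> can be multiplied by \<open>N\<close>.\<close>
  moreover have "M * V = V * N"
  proof -
    have "N1 * N = 1\<^sub>m m" using mat_mult_left_right_inverse[OF N c(2) NN1] .
    then have "M * V = M * V * (N1 * N)" using M(3) V by simp
    also have "\<dots> = M * V * N1 * N" using M(3) V c N by (simp add: mult_mat_assoc)
    finally show ?thesis by (simp only: MVN)
  qed
  ultimately show ?case using ev(3) by simp
next
  case (VarA j)
  then show ?case using assms(6) by auto
next
  case (VarX k)
  then show ?case using assms(7) by auto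
qed

lemma rat_val_carrier:
  assumes "nc_rational r" "P \<in> rat_dom r n"
  shows "rat_val r n P \<in> carrier_mat n n"
proof -
  obtain e M where "e \<in> r" "nc_eval n e P = Some M" "P \<in> mat_tuples n"
    using assms(2) by (auto simp: rat_dom_def)
  then show ?thesis using assms(1) rat_val_eq nc_eval_carrier by metis
qed

text \<open>An expression of \<open>r\<close> that is defined at \<open>P\<close> is also defined at
  \<open>Q\<close>, so a single expression computes both values and the intertwining passes to
  them.\<close>

lemma rat_val_intertwined:
  assumes r: "nc_rational r" and P: "P \<in> rat_dom r n" and Q: "Q \<in> mat_tuples m"
    and "V \<in> carrier_mat n m" "L \<in> carrier_mat m n" "L * V = 1\<^sub>m m"
    and "\<And>j. fst P j * V = V * fst Q j" "\<And>k. snd P k * V = V * snd Q k"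
  shows "rat_val r n P * V = V * rat_val r m Q"
proof -
  obtain e M where e: "e \<in> r" "nc_eval n e P = Some M" and P': "P \<in> mat_tuples n"
    using P by (auto simp: rat_dom_def)
  obtain N where N: "nc_eval m e Q = Some N" "M * V = V * N"
    using nc_eval_intertwined[OF P' Q assms(4-8) e(2)] by blast
  show "rat_val r n P * V = V * rat_val r m Q"
    using N(2) rat_val_eq[OF r e(1) P' e(2)] rat_val_eq[OF r e(1) Q N(1)] by simp
qed

section \<open>Midpoints as compressions of direct sums\<close>

text \<open>The offset \<open>s\<close> is the first row of an identity block. The values
  \<open>0\<close> and \<open>n\<close> give the inclusions of the first and the second summand of a
  direct sum.\<close>

definition summand_mat :: "nat \<Rightarrow> nat \<Rightarrow> complex mat" where
  "summand_mat n s = mat (n + n) n (\<lambda>(i, j). if i = s + j then 1 else 0)"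

text \<open>The diagonal embedding of a vector \<open>u\<close> as \<open>(u, u)\<close>, scaled to
  preserve norms.\<close>

definition diagonal_mat_iso :: "nat \<Rightarrow> complex mat" where
  "diagonal_mat_iso n =
    complex_of_real (1 / sqrt 2) \<cdot>\<^sub>m (summand_mat n 0 + summand_mat n n)"

lemma summand_mat_carrier [simp]: "summand_mat n s \<in> carrier_mat (n + n) n"
  by (simp add: summand_mat_def)

lemma dim_summand_mat [simp]:
  "dim_row (summand_mat n s) = n + n" "dim_col (summand_mat n s) = n"
  by (simp_all add: summand_mat_def)

lemma diagonal_mat_iso_carrier [simp]: "diagonal_mat_iso n \<in> carrier_mat (n + n) n"
  by (simp add: diagonal_mat_iso_def)

lemma dim_diagonal_mat_iso [simp]:
  "dim_row (diagonal_mat_iso n) = n + n" "dim_col (diagonal_mat_iso n) = n"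
  by (simp_all add: diagonal_mat_iso_def)

lemma summand_mat_adjoint_mult:
  assumes "s \<le> n" "t \<le> n"
  shows "mat_adjoint (summand_mat n s) * summand_mat n t =
    mat n n (\<lambda>(i, j). if s + i = t + j then 1 else 0)"
proof (intro eq_matI)
  fix i j assume "i < dim_row (mat n n (\<lambda>(i, j). if s + i = t + j then 1 else (0::complex)))"
    "j < dim_col (mat n n (\<lambda>(i, j). if s + i = t + j then 1 else (0::complex)))"
  then have ij: "i < n" "j < n" by auto
  \<comment> \<open>Column \<open>i\<close> of the first inclusion has its only nonzero entry in row
    \<open>s + i\<close>, which is below \<open>n + n\<close> because
    \<open>s \<le> n\<close>.\<close>
  have "(mat_adjoint (summand_mat n s) * summand_mat n t) $$ (i, j) =
      (\<Sum>k<n + n. if k = s + i then (if k = t + j then 1 else 0) else 0)"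
    using ij
    by (subst index_mult_mat_sum) (auto simp: summand_mat_def simp del: sum.delta intro!: sum.cong)
  also have "\<dots> = (if s + i = t + j then 1 else 0)"
    using ij assms by simp
  finally show "(mat_adjoint (summand_mat n s) * summand_mat n t) $$ (i, j) =
      mat n n (\<lambda>(i, j). if s + i = t + j then 1 else 0) $$ (i, j)"
    using ij by simp
qed auto

lemma summand_mat_orthonormal:
  "mat_adjoint (summand_mat n 0) * summand_mat n 0 = 1\<^sub>m n"
  "mat_adjoint (summand_mat n n) * summand_mat n n = 1\<^sub>m n"
  "mat_adjoint (summand_mat n 0) * summand_mat n n = 0\<^sub>m n n"
  "mat_adjoint (summand_mat n n) * summand_mat n 0 = 0\<^sub>m n n"
  unfolding summand_mat_adjoint_mult[OF le0 le0] summand_mat_adjoint_mult[OF order_refl order_refl]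
    summand_mat_adjoint_mult[OF le0 order_refl] summand_mat_adjoint_mult[OF order_refl le0]
  by (intro eq_matI; simp)+

lemma direct_sum_carrier [simp]:
  "M \<in> carrier_mat m m \<Longrightarrow> N \<in> carrier_mat n n \<Longrightarrow> direct_sum M N \<in> carrier_mat (m + n) (m + n)"
  unfolding direct_sum_def by (intro carrier_matI) (auto simp: dim_diag_block_mat simp del: diag_block_mat.simps)

lemma direct_sum_summand_mat:
  assumes M: "M \<in> carrier_mat n n" and N: "N \<in> carrier_mat n n"
  shows "direct_sum M N * summand_mat n 0 = summand_mat n 0 * M"
    and "direct_sum M N * summand_mat n n = summand_mat n n * N"
proof -
  have *: "(direct_sum M N * summand_mat n s) $$ (i, j) = direct_sum M N $$ (i, s + j)"
    if "i < n + n" "j < n" "s \<le> n" for i j s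
  proof -
    have "(direct_sum M N * summand_mat n s) $$ (i, j) =
        (\<Sum>k<n + n. if k = s + j then direct_sum M N $$ (i, k) else 0)"
      using that direct_sum_carrier[OF M N]
      by (subst index_mult_mat_sum) (auto simp: summand_mat_def simp del: sum.delta intro!: sum.cong)
    then show ?thesis using that by simp
  qed
  have **: "(summand_mat n s * K) $$ (i, j) = (if s \<le> i \<and> i < s + n then K $$ (i - s, j) else 0)"
    if "i < n + n" "j < n" "K \<in> carrier_mat n n" for i j s K
  proof -
    \<comment> \<open>The guard \<open>s \<le> i\<close> is essential: subtraction of naturals
      truncates, so \<open>k = i - s\<close> alone would also select \<open>k = 0\<close> for rows
      above the block.\<close>
    have "(summand_mat n s * K) $$ (i, j) =
        (\<Sum>k<n. if k = i - s then (if s \<le> i then K $$ (k, j) else 0) else 0)"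
      using that
      by (subst index_mult_mat_sum) (auto simp: summand_mat_def simp del: sum.delta intro!: sum.cong)
    then show ?thesis using that by auto
  qed
  show "direct_sum M N * summand_mat n 0 = summand_mat n 0 * M"
    using M N direct_sum_carrier[OF M N]
    by (intro eq_matI) (auto simp: * ** simp del: index_mult_mat(1), auto simp: direct_sum_def Let_def)
  show "direct_sum M N * summand_mat n n = summand_mat n n * N"
    using M N direct_sum_carrier[OF M N]
    by (intro eq_matI) (auto simp: * ** simp del: index_mult_mat(1), auto simp: direct_sum_def Let_def)
qed

text \<open>The cross terms vanish by orthogonality of the two inclusions, and the two scalars
  multiply to \<open>1/2\<close>. The matrix \<open>R\<close> is given only through its action on
  the inclusions because this is what is known of the value of a rational function at a direct
  sum.\<close>

lemma compress_diagonal_mat_iso: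
  assumes R: "R \<in> carrier_mat (n + n) (n + n)"
    and R1: "R1 \<in> carrier_mat n n" and R2: "R2 \<in> carrier_mat n n"
    and eq: "R * summand_mat n 0 = summand_mat n 0 * R1" "R * summand_mat n n = summand_mat n n * R2"
  shows "compress (diagonal_mat_iso n) R = (1 / 2) \<cdot>\<^sub>m (R1 + R2)"
proof -
  define c where "c = complex_of_real (1 / sqrt 2)"
  define J where "J = summand_mat n 0"
  define K where "K = summand_mat n n"
  have cc: "cnj c = c" "c * c = 1 / 2"
    by (simp_all add: c_def flip: of_real_mult)
  have d: "J \<in> carrier_mat (n + n) n" "K \<in> carrier_mat (n + n) n" by (simp_all add: J_def K_def)
  have left: "mat_adjoint J * (J * M) = M" "mat_adjoint K * (K * M) = M"
    "mat_adjoint J * (K * M) = 0\<^sub>m n n" "mat_adjoint K * (J * M) = 0\<^sub>m n n"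
    if "M \<in> carrier_mat n n" for M
    using that summand_mat_orthonormal[of n] d
    by (simp_all add: J_def[symmetric] K_def[symmetric] flip: mult_mat_assoc)
  have "compress (diagonal_mat_iso n) R = mat_adjoint (c \<cdot>\<^sub>m (J + K)) * (R * (c \<cdot>\<^sub>m (J + K)))"
    using R d by (simp add: compress_def diagonal_mat_iso_def c_def J_def K_def mult_mat_assoc)
  also have "R * (c \<cdot>\<^sub>m (J + K)) = c \<cdot>\<^sub>m (J * R1 + K * R2)"
    using R d eq by (simp add: mat_ring_simps J_def K_def)
  also have "mat_adjoint (c \<cdot>\<^sub>m (J + K)) * (c \<cdot>\<^sub>m (J * R1 + K * R2)) =
      (1 / 2) \<cdot>\<^sub>m ((mat_adjoint J + mat_adjoint K) * (J * R1 + K * R2))"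
    using d R1 R2
    by (simp add: mat_adjoint_smult mat_adjoint_add smult_mat_mult mult_mat_smult smult_smult_mat cc)
  also have "(mat_adjoint J + mat_adjoint K) * (J * R1 + K * R2) = R1 + R2"
    using d R1 R2 by (simp add: mult_mat_add add_mat_mult left)
  finally show ?thesis .
qed

lemma compress_direct_sum:
  assumes "M \<in> carrier_mat n n" "N \<in> carrier_mat n n"
  shows "compress (diagonal_mat_iso n) (direct_sum M N) = (1 / 2) \<cdot>\<^sub>m (M + N)"
  using assms by (intro compress_diagonal_mat_iso direct_sum_carrier direct_sum_summand_mat)

lemma half_add_self: "(1 / 2) \<cdot>\<^sub>m (M + M :: complex mat) = M"
  by (intro eq_matI) auto

text \<open>The compression formula at the identity reads
  \<open>V\<^sup>* V = (1 + 1)/2\<close>.\<close>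

lemma diagonal_mat_iso_isometry: "0 < n \<Longrightarrow> isometry_mat (n + n) n (diagonal_mat_iso n)"
  using compress_diagonal_mat_iso[of "1\<^sub>m (n + n)" n "1\<^sub>m n" "1\<^sub>m n"]
  by (simp add: isometry_mat_def compress_def half_add_self)

text \<open>With equal blocks the averages are trivial: the direct sum compresses to
  \<open>A j\<close> and its square to \<open>A j * A j\<close>.\<close>

lemma diagonal_mat_iso_a2_isometry:
  assumes "0 < n" and A: "\<And>j. A j \<in> carrier_mat n n"
  shows "a2_isometry (n + n) n (diagonal_mat_iso n) (\<lambda>j. direct_sum (A j) (A j))"
  unfolding a2_isometry_def
proof (intro conjI allI)
  fix j
  let ?B = "direct_sum (A j) (A j)"
  have B: "?B \<in> carrier_mat (n + n) (n + n)" using A by simp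
  have "?B * ?B * summand_mat n 0 = summand_mat n 0 * (A j * A j)"
    "?B * ?B * summand_mat n n = summand_mat n n * (A j * A j)"
    by (rule mult_intertwined[OF B B A A summand_mat_carrier]; rule direct_sum_summand_mat[OF A A])+
  then have "compress (diagonal_mat_iso n) (?B * ?B) = (1 / 2) \<cdot>\<^sub>m (A j * A j + A j * A j)"
    using A[of j] mult_carrier_mat[OF B B] by (intro compress_diagonal_mat_iso) auto
  then show "compress (diagonal_mat_iso n) (?B * ?B) =
      compress (diagonal_mat_iso n) ?B * compress (diagonal_mat_iso n) ?B"
    using A by (simp add: compress_direct_sum half_add_self)
qed (rule diagonal_mat_iso_isometry[OF assms(1)])

lemma compress_tuple_diagonal_mat_iso:
  assumes "\<And>j. A j \<in> carrier_mat n n" "\<And>k. X k \<in> carrier_mat n n" "\<And>k. Y k \<in> carrier_mat n n"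
  shows "compress_tuple (diagonal_mat_iso n) (direct_sum_tuple (A, X) (A, Y)) =
    (A, midpoint_tuple X Y)"
  using assms
  by (simp add: compress_tuple_def direct_sum_tuple_def midpoint_tuple_def half_add_self
      compress_direct_sum)

text \<open>Positivity of \<open>n\<close> comes from the empty component at \<open>0\<close>; it is
  required of the source dimension of an isometry.\<close>

lemma graded_subset_carrier:
  assumes "graded_subset D" "(A, X) \<in> D n"
  shows "0 < n" "A j \<in> carrier_mat n n" "X k \<in> carrier_mat n n" "mat_adjoint (A j) = A j"
    "mat_adjoint (X k) = X k" "(A, X) \<in> mat_tuples n"
proof -
  have "(A, X) \<in> herm_tuples n" using assms by (auto simp: graded_subset_def)
  moreover have "n \<noteq> 0" using assms by (intro notI) (simp add: graded_subset_def)
  ultimately show "0 < n" "A j \<in> carrier_mat n n" "X k \<in> carrier_mat n n" "mat_adjoint (A j) = A j"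
    "mat_adjoint (X k) = X k" "(A, X) \<in> mat_tuples n"
    by (auto simp: herm_tuples_def mat_tuples_def)
qed

text \<open>Convexity in \<open>x\<close> only speaks of midpoints inside the set. Here they are
  compressions of direct sums by an admissible isometry.\<close>

lemma midpoint_mem:
  assumes D: "graded_subset D" and free: "free_set D" and a2: "a2_convex_set D"
    and X: "(A, X) \<in> D n" and Y: "(A, Y) \<in> D n"
  shows "(A, midpoint_tuple X Y) \<in> D n"
proof -
  note cX = graded_subset_carrier[OF D X] and cY = graded_subset_carrier[OF D Y]
  have "(\<lambda>j. direct_sum (A j) (A j), \<lambda>k. direct_sum (X k) (Y k)) \<in> D (n + n)"
    using free X Y unfolding free_set_def direct_sum_tuple_def by fastforce
  then have "compress_tuple (diagonal_mat_iso n) (direct_sum_tuple (A, X) (A, Y)) \<in> D n"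
    using a2 diagonal_mat_iso_a2_isometry[of n A, OF cX(1,2)]
    unfolding a2_convex_set_def direct_sum_tuple_def by simp
  then show ?thesis using cX cY by (simp add: compress_tuple_diagonal_mat_iso)
qed

section \<open>The equivalence\<close>

lemma a2_convex_imp_convex_in_x:
  assumes D: "graded_subset D" and free: "free_set D"
    and r: "nc_rational r" and dom: "\<And>n. D n \<subseteq> rat_dom r n" and conv: "a2_convex_on D r"
  shows "convex_in_x_on D r"
  unfolding convex_in_x_on_def
proof (intro allI impI, elim conjE)
  fix n A X Y
  assume X: "(A, X) \<in> D n" and Y: "(A, Y) \<in> D n" and XY: "(A, midpoint_tuple X Y) \<in> D n"
  note cX = graded_subset_carrier[OF D X] and cY = graded_subset_carrier[OF D Y]
  let ?P = "direct_sum_tuple (A, X) (A, Y)" and ?V = "diagonal_mat_iso n"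
  have P: "?P \<in> D (n + n)" using free X Y by (simp add: free_set_def)
  have Pd: "?P \<in> rat_dom r (n + n)" using P dom by blast
  have mid: "compress_tuple ?V ?P = (A, midpoint_tuple X Y)"
    using cX cY by (intro compress_tuple_diagonal_mat_iso) auto
  have "loewner_le n (rat_val r n (compress_tuple ?V ?P)) (compress ?V (rat_val r (n + n) ?P))"
    using conv P XY diagonal_mat_iso_a2_isometry[of n A, OF cX(1,2)] unfolding a2_convex_on_def mid[symmetric]
    by (simp add: direct_sum_tuple_def)
  \<comment> \<open>The value at the direct sum is intertwined by the two inclusions with the values
    at the summands, so its compression is their mean.\<close>
  moreover have "compress ?V (rat_val r (n + n) ?P) =
      (1 / 2) \<cdot>\<^sub>m (rat_val r n (A, X) + rat_val r n (A, Y))"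
  proof (rule compress_diagonal_mat_iso)
    show "rat_val r (n + n) ?P * summand_mat n 0 = summand_mat n 0 * rat_val r n (A, X)"
      using cX cY
      by (intro rat_val_intertwined[OF r Pd, where L = "mat_adjoint (summand_mat n 0)"])
        (auto simp: direct_sum_tuple_def direct_sum_summand_mat summand_mat_orthonormal)
    show "rat_val r (n + n) ?P * summand_mat n n = summand_mat n n * rat_val r n (A, Y)"
      using cX cY
      by (intro rat_val_intertwined[OF r Pd, where L = "mat_adjoint (summand_mat n n)"])
        (auto simp: direct_sum_tuple_def direct_sum_summand_mat summand_mat_orthonormal)
  qed (use rat_val_carrier[OF r] dom X Y Pd in blast)+
  ultimately show "loewner_le n (rat_val r n (A, midpoint_tuple X Y))
      ((1 / 2) \<cdot>\<^sub>m (rat_val r n (A, X) + rat_val r n (A, Y)))"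
    by (simp add: mid)
qed

section \<open>Reflections in the range of an isometry\<close>

definition reflection_mat :: "nat \<Rightarrow> complex mat \<Rightarrow> complex mat" where
  "reflection_mat n V = V * mat_adjoint V + V * mat_adjoint V - 1\<^sub>m n"

lemma reflection_mat_carrier [simp]:
  "V \<in> carrier_mat n m \<Longrightarrow> reflection_mat n V \<in> carrier_mat n n"
  by (auto simp: reflection_mat_def intro!: carrier_matI)

lemma dim_reflection_mat [simp]:
  "dim_row (reflection_mat n V) = n" "dim_col (reflection_mat n V) = n"
  by (simp_all add: reflection_mat_def)

lemma mat_adjoint_reflection_mat:
  "V \<in> carrier_mat n m \<Longrightarrow> mat_adjoint (reflection_mat n V) = reflection_mat n V"
  by (simp add: reflection_mat_def mat_adjoint_minus mat_adjoint_add mat_adjoint_mult)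

lemma add_self_diff: "(M + M :: complex mat) - M = M"
  by (intro eq_matI) auto

text \<open>For an isometry \<open>V\<close>, the matrix \<open>V V\<^sup>*\<close> is the
  projection onto its range, and the reflection is \<open>1\<close> on the range and
  \<open>-1\<close> on the orthogonal complement.\<close>

lemma reflection_mat_mult:
  assumes V: "V \<in> carrier_mat n m" and iso: "mat_adjoint V * V = 1\<^sub>m m"
  shows "reflection_mat n V * V = V"
    and "mat_adjoint V * reflection_mat n V = mat_adjoint V"
    and "reflection_mat n V * reflection_mat n V = 1\<^sub>m n"
proof -
  let ?S = "reflection_mat n V"
  show SV: "?S * V = V"
    using V by (simp add: reflection_mat_def mat_ring_simps iso add_self_diff)
  then have "mat_adjoint (?S * V) = mat_adjoint V" by simp
  then show "mat_adjoint V * ?S = mat_adjoint V"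
    using V by (simp add: mat_adjoint_mult mat_adjoint_reflection_mat)
  have S: "?S \<in> carrier_mat n n" using V by simp
  have "?S * (V * mat_adjoint V) = V * mat_adjoint V"
    using V S SV by (simp flip: mult_mat_assoc)
  then have "?S * ?S = V * mat_adjoint V + V * mat_adjoint V - ?S"
    using V S by (subst (2) reflection_mat_def) (simp add: mult_mat_minus mult_mat_add)
  also have "\<dots> = 1\<^sub>m n"
    using V by (intro eq_matI) (auto simp: reflection_mat_def)
  finally show "?S * ?S = 1\<^sub>m n" .
qed

text \<open>Taking adjoints turns \<open>A V = V B\<close> into
  \<open>V\<^sup>* A = B V\<^sup>*\<close>. Both \<open>A V V\<^sup>*\<close> and
  \<open>V V\<^sup>* A\<close> then equal \<open>V B V\<^sup>*\<close>, so \<open>A\<close> commutes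
  with the projection.\<close>

lemma reflection_mat_commute:
  assumes V: "V \<in> carrier_mat n m" and A: "A \<in> carrier_mat n n" and B: "B \<in> carrier_mat m m"
    and herm: "mat_adjoint A = A" "mat_adjoint B = B" and AV: "A * V = V * B"
  shows "A * reflection_mat n V = reflection_mat n V * A"
proof -
  have "mat_adjoint (A * V) = mat_adjoint (V * B)" using AV by simp
  then have VA: "mat_adjoint V * A = B * mat_adjoint V"
    using V A B herm by (simp add: mat_adjoint_mult)
  have "A * (V * mat_adjoint V) = V * (B * mat_adjoint V)"
    using V A B AV by (simp flip: mult_mat_assoc)
  also have "\<dots> = (V * mat_adjoint V) * A"
    using V A B by (simp add: mult_mat_assoc VA)
  finally have "A * (V * mat_adjoint V) = (V * mat_adjoint V) * A" .
  then show ?thesis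
    using V A by (simp add: reflection_mat_def mult_mat_minus mult_mat_add minus_mat_mult add_mat_mult)
qed

lemma convex_in_x_imp_a2_convex:
  assumes D: "graded_subset D" and free: "free_set D" and a2: "a2_convex_set D"
    and r: "nc_rational r" and dom: "\<And>n. D n \<subseteq> rat_dom r n" and conv: "convex_in_x_on D r"
  shows "a2_convex_on D r"
  unfolding a2_convex_on_def
proof (intro allI impI, elim conjE)
  fix n m V A X
  assume X: "(A, X) \<in> D n" and "a2_isometry n m V A" and VX: "compress_tuple V (A, X) \<in> D m"
  then have V: "V \<in> carrier_mat n m" and iso: "mat_adjoint V * V = 1\<^sub>m m"
    and sq: "\<And>j. compress V (A j * A j) = compress V (A j) * compress V (A j)"
    by (auto simp: a2_isometry_def isometry_mat_def)
  note c = graded_subset_carrier[OF D X]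
  have AV: "A j * V = V * compress V (A j)" for j
    using compress_square_imp_intertwined[OF V iso c(2,4) sq] .
  define S where "S = reflection_mat n V"
  have S: "S \<in> carrier_mat n n" "mat_adjoint S = S" "S * V = V" "mat_adjoint V * S = mat_adjoint V"
    "S * S = 1\<^sub>m n"
    using V iso by (simp_all add: S_def mat_adjoint_reflection_mat reflection_mat_mult)
  have AS: "A j * S = S * A j" for j
    unfolding S_def using V c(2,4)[of j] AV[of j]
    by (intro reflection_mat_commute[where B = "compress V (A j)"])
      (auto simp: compress_def mat_adjoint_mult mult_mat_assoc)
  have SA: "compress S (A j) = A j" for j
    using compress_intertwined[OF S(1) _ c(2) c(2)] S AS by simp
  \<comment> \<open>Conjugation by the unitary \<open>S\<close> fixes every \<open>A j\<close>, so
    it changes only the \<open>x\<close>-part and stays in the set.\<close>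
  define Y where "Y = (\<lambda>k. compress S (X k))"
  have Y: "(A, Y) \<in> D n"
  proof -
    have "compress_tuple S (A, X) \<in> D n"
      using free X S unfolding free_set_def unitary_mat_def by auto
    then show ?thesis by (simp add: compress_tuple_def SA Y_def)
  qed
  note cY = graded_subset_carrier[OF D Y]
  have mid: "(A, midpoint_tuple X Y) \<in> D n"
    by (rule midpoint_mem[OF D free a2 X Y])
  let ?R = "rat_val r n (A, X)"
  have R: "?R \<in> carrier_mat n n"
    using rat_val_carrier[OF r] X dom by blast
  \<comment> \<open>\<open>S\<close> is its own inverse and so serves both as the intertwiner and as
    its left inverse.\<close>
  have RS: "?R * S = S * rat_val r n (A, Y)"
  proof (rule rat_val_intertwined[OF r _ _ S(1) S(1) S(5)])
    show "snd (A, X) k * S = S * snd (A, Y) k" for k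
    proof -
      have "S * (mat_adjoint S * X k * S) = (S * S) * (X k * S)"
        using S(1,2) c(3)[of k] by (simp add: mult_mat_assoc)
      then show ?thesis using S c(3)[of k] by (simp add: Y_def compress_def)
    qed
  qed (use X Y dom AS cY in auto)
  have RY: "rat_val r n (A, Y) \<in> carrier_mat n n"
    using rat_val_carrier[OF r] Y dom by blast
  \<comment> \<open>The values at \<open>X\<close> and \<open>Y\<close> are conjugate under
    \<open>S\<close>, which acts trivially on the range of \<open>V\<close>.\<close>
  have comp: "compress V (rat_val r n (A, Y)) = compress V ?R"
  proof -
    have "compress V ?R = mat_adjoint V * (?R * S * V)"
      using V S R by (simp add: compress_def mult_mat_assoc)
    also have "\<dots> = (mat_adjoint V * S) * (rat_val r n (A, Y) * V)"
      using V S(1) RY by (simp add: RS mult_mat_assoc)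
    finally show ?thesis using V RY by (simp add: S(4) compress_def mult_mat_assoc)
  qed
  \<comment> \<open>As \<open>S V = V\<close>, the left side is the mean of \<open>X k V\<close> and
    \<open>S X k V\<close>. The mean of \<open>1\<close> and \<open>S\<close> is the projection
    \<open>V V\<^sup>*\<close>.\<close>
  have midV: "midpoint_tuple X Y k * V = V * compress V (X k)" for k
  proof -
    have "compress S (X k) * V = S * (X k * V)"
      using S c(3)[of k] V by (simp add: compress_def mult_mat_assoc)
    then have "midpoint_tuple X Y k * V = (1 / 2) \<cdot>\<^sub>m (X k * V + S * (X k * V))"
      using S c(3)[of k] cY(3)[of k] V
      by (simp add: midpoint_tuple_def Y_def smult_mat_mult add_mat_mult)
    also have "X k * V + S * (X k * V) = V * compress V (X k) + V * compress V (X k)"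
    proof -
      have XV: "X k * V \<in> carrier_mat n m" using c(3)[of k] V by simp
      have "S * (X k * V) = V * compress V (X k) + V * compress V (X k) - X k * V"
        using V c(3)[of k] XV
        by (simp add: S_def reflection_mat_def compress_def minus_mat_mult add_mat_mult mult_mat_assoc)
      then show ?thesis
        using V c(3)[of k] by (simp add: mat_add_diff_cancel)
    qed
    finally show ?thesis by (simp add: half_add_self)
  qed
  \<comment> \<open>\<open>V\<close> intertwines the midpoint tuple with the compressed tuple, in
    \<open>a\<close> by \<open>AV\<close> and in \<open>x\<close> by \<open>midV\<close>. Hence the
    value at the midpoint compresses to the value at the compressed tuple.\<close>
  have "rat_val r n (A, midpoint_tuple X Y) * V = V * rat_val r m (compress_tuple V (A, X))"
  proof (rule rat_val_intertwined[OF r _ _ V _ iso])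
    show "compress_tuple V (A, X) \<in> mat_tuples m"
      using V by (simp add: mat_tuples_def compress_tuple_def)
  qed (use mid dom V AV midV in \<open>auto simp: compress_tuple_def\<close>)
  then have "compress V (rat_val r n (A, midpoint_tuple X Y)) =
      rat_val r m (compress_tuple V (A, X))"
    using V iso mid VX dom rat_val_carrier[OF r] by (intro compress_intertwined) blast+
  moreover have "compress V ((1 / 2) \<cdot>\<^sub>m (?R + rat_val r n (A, Y))) = compress V ?R"
  proof -
    have "compress V ((1 / 2) \<cdot>\<^sub>m (?R + rat_val r n (A, Y))) =
        (1 / 2) \<cdot>\<^sub>m (compress V ?R + compress V (rat_val r n (A, Y)))"
      using V R RY by (simp add: compress_def mat_ring_simps)
    then show ?thesis by (simp add: comp half_add_self)
  qed
  moreover have "loewner_le n (rat_val r n (A, midpoint_tuple X Y))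
      ((1 / 2) \<cdot>\<^sub>m (?R + rat_val r n (A, Y)))"
    using conv X Y mid by (simp add: convex_in_x_on_def)
  ultimately show "loewner_le m (rat_val r m (compress_tuple V (A, X))) (compress V ?R)"
    using compress_loewner_le[OF _ V] by metis
qed

theorem proposition1p5:
  fixes D :: "nat \<Rightarrow> ('h::finite, 'g::finite) mat_tuple set"
    and r :: "('h, 'g) nc_expr set"
  assumes "graded_subset D"
    and "free_set D"
    and "closed_under_reducing D"
    and "a2_convex_set D"
    and "nc_rational r"
    and "symmetric_rat r"
    and "\<And>n. D n \<subseteq> rat_dom r n"
  shows "a2_convex_on D r \<longleftrightarrow> convex_in_x_on D r"
  using a2_convex_imp_convex_in_x[OF assms(1,2,5,7)]
    convex_in_x_imp_a2_convex[OF assms(1,2,4,5,7)] by blast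

end
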